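(* Let $H$ be the set of $x\in[0,1)$ in whose ternary representation each of the digits $0,1,2$ has frequency $\frac13$, and let $f$ be the function on $[0,1)$ defined as follows. If $x\in[0,1)\setminus H$, then $f(x)=x$. If $x\in H$ has ternary digits $(\alpha_n)_{n\ge1}$ and $n_1<n_2<\cdots$ are all the positions $n$ with $\alpha_n=1$, then $f(x)=\sum_{n\ge1}\beta_n3^{-n}$, where $\beta_n=\alpha_n$ whenever $\alpha_n\ne1$, and $$\beta_{n_k}=\begin{cases}0,& k\equiv0\pmod 7,\\ 2,& k\equiv1\pmod 7,\\ \alpha_{n_k}=1,&\text{otherwise.}\end{cases}$$ Then for every $x\in H$, $$\nu_0(f(x))=\frac{8}{21},\qquad \nu_1(f(x))=\frac{5}{21},\qquad \nu_2(f(x))=\frac{8}{21}.$$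
   Context: Every $x\in[0,1)$ is written in its ternary representation $x=\sum_{k\ge1}\alpha_k(x)3^{-k}$ with $\alpha_k(x)\in\{0,1,2\}$; for numbers with two such representations the one ending in period $(0)$ is used (never the one ending in period $(2)$). For $i\in\{0,1,2\}$ the frequency of the digit $i$ is $\nu_i(x)=\lim_{n\to\infty}\frac1n\#\{j\le n:\alpha_j(x)=i\}$, if the limit exists. *)

theory Defs
  imports Complex_Main
begin

text \<open>Positions of digits start at 1; the entry at index 0 is a dummy, fixed to be 0 so that the
  representing sequence is unique.\<close>

definition ternary_rep :: "real \<Rightarrow> (nat \<Rightarrow> nat) \<Rightarrow> bool" where
  "ternary_rep x a \<longleftrightarrow>
     a 0 = 0 \<and> (\<forall>n\<ge>1. a n \<in> {0, 1, 2}) \<and>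
     (\<lambda>n. real (a (Suc n)) / 3 ^ Suc n) sums x \<and>
     \<not> (\<exists>N. \<forall>n\<ge>N. a n = 2)"

definition ternary_digit :: "real \<Rightarrow> nat \<Rightarrow> nat" where
  "ternary_digit x = (THE a. ternary_rep x a)"

lemma ternary_rep_floor:
  assumes "ternary_rep x a"
  shows "\<lfloor>3 ^ n * x\<rfloor> = (\<Sum>k<n. int (a (Suc k)) * 3 ^ (n - Suc k))"
proof -
  define g where "g k = real (a (Suc k)) / 3 ^ Suc k" for k
  have sums: "g sums x" and dig: "\<And>k. a (Suc k) \<in> {0,1,2}"
    and no2: "\<And>N. \<exists>m\<ge>N. a m \<noteq> 2"
    using assms unfolding ternary_rep_def g_def by auto
  have le2: "real (a (Suc k)) \<le> 2" for k
    using dig[of k] by auto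
  have tail: "(\<lambda>k. g (k + n)) sums (x - (\<Sum>k<n. g k))"
    using sums by (simp add: sums_iff_shift)
  have geo: "(\<lambda>k. 2 / 3 ^ Suc (k + n) :: real) sums (1 / 3 ^ n)"
  proof -
    have "(\<lambda>k. (2 / 3 ^ Suc n) * (1/3 :: real) ^ k) sums ((2 / 3 ^ Suc n) * (1 / (1 - 1/3)))"
      by (intro sums_mult geometric_sums) simp
    then show ?thesis
      by (simp add: field_simps power_add)
  qed
  have lower: "0 \<le> x - (\<Sum>k<n. g k)"
    using sums_le[OF _ sums_zero tail] by (simp add: g_def)
  have upper: "x - (\<Sum>k<n. g k) < 1 / 3 ^ n"
  proof -
    obtain m where m: "m \<ge> Suc n" "a m \<noteq> 2"
      using no2 by blast
    define j where "j = m - Suc n"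
    have j: "m = Suc (j + n)"
      using m by (simp add: j_def)
    have less: "real (a (Suc (j + n))) < 2"
      using dig[of "j + n"] m(2) j by auto
    have d: "(\<lambda>k. 2 / 3 ^ Suc (k + n) - g (k + n)) sums (1 / 3 ^ n - (x - (\<Sum>k<n. g k)))"
      by (rule sums_diff[OF geo tail])
    have nonneg: "0 \<le> 2 / 3 ^ Suc (k + n) - g (k + n)" for k
      using le2[of "k + n"] by (simp add: g_def divide_right_mono)
    have pos: "0 < 2 / 3 ^ Suc (j + n) - g (j + n)"
      using less by (simp add: g_def divide_strict_right_mono)
    have "0 < (\<Sum>k. 2 / 3 ^ Suc (k + n) - g (k + n))"
      by (rule suminf_pos2[OF sums_summable[OF d] nonneg pos])
    then show ?thesis
      using sums_unique[OF d] by simp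
  qed
  have S: "real_of_int (\<Sum>k<n. int (a (Suc k)) * 3 ^ (n - Suc k)) = 3 ^ n * (\<Sum>k<n. g k)"
  proof -
    have "real (a (Suc k)) * 3 ^ (n - Suc k) = 3 ^ n * g k" if "k < n" for k
    proof -
      have "(3::real) ^ n = 3 ^ (n - Suc k) * 3 ^ Suc k"
        using that by (metis Suc_leI le_add_diff_inverse2 power_add)
      then show ?thesis
        by (simp add: g_def)
    qed
    then show ?thesis
      by (simp add: sum_distrib_left)
  qed
  show ?thesis
  proof (rule floor_unique)
    show "real_of_int (\<Sum>k<n. int (a (Suc k)) * 3 ^ (n - Suc k)) \<le> 3 ^ n * x"
      unfolding S using lower by simp
    show "3 ^ n * x < real_of_int (\<Sum>k<n. int (a (Suc k)) * 3 ^ (n - Suc k)) + 1"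
      unfolding S using upper by (simp add: field_simps)
  qed
qed

lemma ternary_rep_digit:
  assumes "ternary_rep x a"
  shows "a n = (if n = 0 then 0 else nat (\<lfloor>3 ^ n * x\<rfloor> mod 3))"
proof (cases n)
  case 0
  then show ?thesis using assms by (simp add: ternary_rep_def)
next
  case (Suc m)
  have "(\<Sum>k<m. int (a (Suc k)) * 3 ^ (Suc m - Suc k)) =
        3 * (\<Sum>k<m. int (a (Suc k)) * 3 ^ (m - Suc k))"
    unfolding sum_distrib_left by (intro sum.cong) (auto simp: Suc_diff_Suc simp flip: power_Suc)
  then have "\<lfloor>3 ^ n * x\<rfloor> = 3 * \<lfloor>3 ^ m * x\<rfloor> + int (a n)"
    using ternary_rep_floor[OF assms, of n] ternary_rep_floor[OF assms, of m] Suc by simp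
  moreover have "a n < 3"
  proof -
    have "a n \<in> {0, 1, 2}"
      using assms Suc unfolding ternary_rep_def by simp
    then show ?thesis by auto
  qed
  ultimately show ?thesis
    using Suc by simp
qed

lemma ternary_rep_exists:
  assumes "0 \<le> x" "x < 1"
  shows "ternary_rep x (\<lambda>n. if n = 0 then 0 else nat (\<lfloor>3 ^ n * x\<rfloor> mod 3))"
    (is "ternary_rep x ?a")
proof -
  define F where "F n = real_of_int \<lfloor>3 ^ n * x\<rfloor>" for n
  have F0: "F 0 = 0"
    using assms by (simp add: F_def floor_eq_iff)
  have step: "F (Suc n) = 3 * F n + real (?a (Suc n))" for n
  proof -
    have b: "F n \<le> 3 ^ n * x" "3 ^ n * x < F n + 1"
      unfolding F_def by linarith+
    have "\<lfloor>3 ^ Suc n * x\<rfloor> div 3 = \<lfloor>3 ^ n * x\<rfloor>"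
      using floor_divide_real_eq_div[of 3 "3 ^ Suc n * x"] by simp
    then have "\<lfloor>3 ^ Suc n * x\<rfloor> = 3 * \<lfloor>3 ^ n * x\<rfloor> + \<lfloor>3 ^ Suc n * x\<rfloor> mod 3"
      by (metis mult_div_mod_eq)
    then have "F (Suc n) = real_of_int (3 * \<lfloor>3 ^ n * x\<rfloor> + \<lfloor>3 ^ Suc n * x\<rfloor> mod 3)"
      unfolding F_def by presburger
    then show ?thesis
      by (simp add: F_def)
  qed
  have partial: "(\<Sum>k<n. real (?a (Suc k)) / 3 ^ Suc k) = F n / 3 ^ n" for n
  proof (induction n)
    case 0
    then show ?case by (simp add: F0)
  next
    case (Suc n)
    show ?case
      unfolding sum.lessThan_Suc Suc.IH step by (simp add: field_simps)
  qed
  have sums: "(\<lambda>n. real (?a (Suc n)) / 3 ^ Suc n) sums x"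
    unfolding sums_def partial
  proof (rule tendsto_sandwich)
    show "\<forall>\<^sub>F n in sequentially. x - (1/3) ^ n \<le> F n / 3 ^ n"
    proof (rule always_eventually, rule allI)
      fix n
      have "3 ^ n * x < F n + 1"
        unfolding F_def by linarith
      then have "x < (F n + 1) / 3 ^ n"
        by (simp add: pos_less_divide_eq mult.commute)
      then show "x - (1/3) ^ n \<le> F n / 3 ^ n"
        by (simp add: power_one_over add_divide_distrib)
    qed
    show "\<forall>\<^sub>F n in sequentially. F n / 3 ^ n \<le> x"
    proof (rule always_eventually, rule allI)
      fix n
      have "F n \<le> 3 ^ n * x"
        unfolding F_def by linarith
      then show "F n / 3 ^ n \<le> x"
        by (simp add: field_simps)
    qed
    have "(\<lambda>n. x - (1/3) ^ n) \<longlonglongrightarrow> x - 0"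
      by (intro tendsto_intros LIMSEQ_realpow_zero) auto
    then show "(\<lambda>n. x - (1/3) ^ n) \<longlonglongrightarrow> x"
      by simp
  qed simp
  have no2: "\<not> (\<exists>N. \<forall>n\<ge>N. ?a n = 2)"
  proof
    assume "\<exists>N. \<forall>n\<ge>N. ?a n = 2"
    then obtain N where N: "\<And>n. n \<ge> N \<Longrightarrow> ?a n = 2"
      by blast
    define d where "d n = F n + 1 - 3 ^ n * x" for n
    have dpos: "d N > 0"
      unfolding d_def F_def by linarith
    have dle: "d n \<le> 1" for n
      unfolding d_def F_def by linarith
    have ds: "d (Suc n) = 3 * d n" if "n \<ge> N" for n
      using N[of "Suc n"] step[of n] that unfolding d_def by (simp add: algebra_simps)
    have dN: "d (N + k) = 3 ^ k * d N" for k
      by (induction k) (simp_all add: ds)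
    obtain k where "1 / d N < 3 ^ k"
      using real_arch_pow[of 3 "1 / d N"] by auto
    then have "1 < 3 ^ k * d N"
      using dpos by (simp add: field_simps)
    then show False
      using dle[of "N + k"] dN[of k] by linarith
  qed
  have dig: "?a n \<in> {0,1,2}" for n
  proof -
    have "nat (\<lfloor>3 ^ n * x\<rfloor> mod 3) < 3"
      by (simp add: nat_less_iff)
    then show ?thesis
      by auto
  qed
  show ?thesis
    unfolding ternary_rep_def
  proof (intro conjI)
    show "?a 0 = 0"
      by simp
    show "\<forall>n\<ge>1. ?a n \<in> {0, 1, 2}"
      using dig by blast
  qed (fact sums no2)+
qed

lemma ternary_rep_ex1:
  assumes "0 \<le> x" "x < 1"
  shows "\<exists>!a. ternary_rep x a"
proof (rule ex1I)
  show "ternary_rep x (\<lambda>n. if n = 0 then 0 else nat (\<lfloor>3 ^ n * x\<rfloor> mod 3))"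
    by (rule ternary_rep_exists[OF assms])
  show "a = (\<lambda>n. if n = 0 then 0 else nat (\<lfloor>3 ^ n * x\<rfloor> mod 3))" if "ternary_rep x a" for a
    using ternary_rep_digit[OF that] by (rule ext)
qed

lemma ternary_rep_ternary_digit:
  assumes "0 \<le> x" "x < 1"
  shows "ternary_rep x (ternary_digit x)"
  unfolding ternary_digit_def by (rule theI'[OF ternary_rep_ex1[OF assms]])

text \<open>The frequency \<open>\<nu>\<^sub>i(x)\<close> exists and equals \<open>l\<close>. It is only defined for \<open>x\<close> in \<open>[0,1)\<close>.\<close>

definition has_digit_freq :: "nat \<Rightarrow> real \<Rightarrow> real \<Rightarrow> bool" where
  "has_digit_freq i x l \<longleftrightarrow>
     x \<in> {0..<1} \<and>
     (\<lambda>n. real (card {j \<in> {1..n}. ternary_digit x j = i}) / real n) \<longlonglongrightarrow> l"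

definition H_set :: "real set" where
  "H_set = {x \<in> {0..<1}. \<forall>i\<in>{0, 1, 2}. has_digit_freq i x (1/3)}"

text \<open>If \<open>n\<close> is a position of the digit 1, then \<open>n = n\<^sub>k\<close> for \<open>k = ones_upto x n\<close>.\<close>

definition ones_upto :: "real \<Rightarrow> nat \<Rightarrow> nat" where
  "ones_upto x n = card {j \<in> {1..n}. ternary_digit x j = 1}"

definition beta :: "real \<Rightarrow> nat \<Rightarrow> nat" where
  "beta x n =
     (if ternary_digit x n \<noteq> 1 then ternary_digit x n
      else if ones_upto x n mod 7 = 0 then 0
      else if ones_upto x n mod 7 = 1 then 2
      else ternary_digit x n)"

definition f_map :: "real \<Rightarrow> real" where
  "f_map x = (if x \<in> H_set then (\<Sum>n. real (beta x (Suc n)) / 3 ^ Suc n) else x)"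

end

theory Submission
  imports Defs
begin

text \<open>Since the digit 0 of \<open>x\<close> has positive frequency, it occurs infinitely often, and \<open>beta\<close> keeps it.
  Hence \<open>beta x\<close> is not eventually 2 and is the canonical digit sequence of \<open>f_map x\<close>.
  Among the first \<open>m\<close> ones of \<open>x\<close>, \<open>m/7 + O(1)\<close> are turned into 0 and equally many into 2,
  so the frequencies become \<open>1/3 + 1/21\<close>, \<open>1/3 - 2/21\<close> and \<open>1/3 + 1/21\<close>.\<close>

text \<open>For \<open>n = 0\<close> the sum in the floor formula is empty, so the floor of
  \<open>x\<close> is 0.\<close>

lemma ternary_rep_unit_interval:
  assumes "ternary_rep x a"
  shows "x \<in> {0..<1}"
  using ternary_rep_floor[OF assms, of 0] by (simp add: floor_eq_iff)

lemma ternary_rep_imp_ternary_digit: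
  assumes "ternary_rep x a"
  shows "ternary_digit x = a"
  using ternary_rep_unit_interval[OF assms] ternary_rep_ex1[of x] assms
  unfolding ternary_digit_def by (intro the1_equality) auto

text \<open>If the digit stopped occurring from position \<open>N\<close> on, its counts would be
  bounded by \<open>N\<close> and its frequency would be 0, against uniqueness of limits.\<close>

lemma has_digit_freq_pos_imp_infinitely_many:
  assumes "has_digit_freq i x l" "l > 0"
  shows "\<exists>n\<ge>N. ternary_digit x n = i"
proof (rule ccontr)
  assume "\<not> ?thesis"
  then have sub: "{j \<in> {1..n}. ternary_digit x j = i} \<subseteq> {..<N}" for n
    by (auto simp: not_le[symmetric])
  have "(\<lambda>n. real (card {j \<in> {1..n}. ternary_digit x j = i}) / real n) \<longlonglongrightarrow> 0"
  proof (rule tendsto_sandwich[OF _ _ tendsto_const lim_const_over_n])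
    show "\<forall>\<^sub>F n in sequentially.
        real (card {j \<in> {1..n}. ternary_digit x j = i}) / real n \<le> real N / real n"
      using card_mono[OF _ sub] by (intro always_eventually allI divide_right_mono) simp_all
  qed simp
  then show False
    using assms LIMSEQ_unique unfolding has_digit_freq_def by fastforce
qed

lemma summable_ternary:
  assumes "\<And>n. a n \<le> (2::nat)"
  shows "summable (\<lambda>n. real (a n) / 3 ^ Suc n)"
proof (rule summable_comparison_test'[where N = 0])
  show "summable (\<lambda>n. (2/3) * (1/3::real) ^ n)"
    by (intro summable_mult summable_geometric) simp
  show "norm (real (a n) / 3 ^ Suc n) \<le> (2/3) * (1/3) ^ n" for n
    using assms[of n] by (simp add: field_simps)
qed

lemma ternary_rep_f_map:
  assumes "x \<in> H_set"
  shows "ternary_rep (f_map x) (beta x)"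
proof -
  have x: "0 \<le> x" "x < 1" and freq0: "has_digit_freq 0 x (1/3)"
    using assms by (auto simp: H_set_def)
  have rep: "ternary_rep x (ternary_digit x)"
    by (rule ternary_rep_ternary_digit[OF x])
  have range: "beta x n \<in> {0, 1, 2}" if "n \<ge> 1" for n
    using rep that by (auto simp: ternary_rep_def beta_def)
  have "beta x (Suc n) \<le> 2" for n
    using range[of "Suc n"] by auto
  then have "(\<lambda>n. real (beta x (Suc n)) / 3 ^ Suc n) sums f_map x"
    using assms by (auto simp: f_map_def intro!: summable_sums summable_ternary simp del: power_Suc)
  moreover have "\<not> (\<exists>N. \<forall>n\<ge>N. beta x n = 2)"
    using has_digit_freq_pos_imp_infinitely_many[OF freq0]
    by (force simp: beta_def)
  \<comment> \<open>The dummy entry of \<open>x\<close> is 0 and not 1, so \<open>beta\<close>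
    leaves it alone.\<close>
  moreover have "beta x 0 = 0"
    using rep by (simp add: ternary_rep_def beta_def)
  ultimately show ?thesis
    using range unfolding ternary_rep_def by blast
qed

lemma card_filter_Suc:
  "card {j \<in> {1..Suc n}. P j} = card {j \<in> {1..n}. P j} + (if P (Suc n) then 1 else 0)"
proof -
  have "{j \<in> {1..Suc n}. P j} =
      (if P (Suc n) then insert (Suc n) {j \<in> {1..n}. P j} else {j \<in> {1..n}. P j})"
    by (auto simp: le_Suc_eq)
  then show ?thesis
    by simp
qed

text \<open>Each new position satisfying \<open>P\<close> raises the rank by exactly one, so the
  ranks met up to \<open>n\<close> run once through 1, 2, ... up to their number. With
  \<open>P\<close> for the digit 1 and \<open>Q\<close> for a residue modulo 7, counting changed
  ones becomes counting integers in a residue class.\<close>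

lemma card_filter_rank:
  fixes n :: nat
  shows "card {j \<in> {1..n}. P j \<and> Q (card {i \<in> {1..j}. P i})} =
   card {k \<in> {1..card {i \<in> {1..n}. P i}}. Q k}"
proof (induction n)
  case (Suc n)
  have step: "card {i \<in> {1..Suc n}. P i} = Suc (card {i \<in> {1..n}. P i})" if "P (Suc n)"
    using that by (simp only: card_filter_Suc) simp
  show ?case
  proof (cases "P (Suc n)")
    case True
    then show ?thesis
      unfolding card_filter_Suc[of n "\<lambda>j. P j \<and> Q (card {i \<in> {1..j}. P i})"] Suc.IH step[OF True]
        card_filter_Suc[of "card {i \<in> {1..n}. P i}" Q] by simp
  next
    case False
    then show ?thesis
      using Suc.IH by (simp only: card_filter_Suc) simp
  qed
qed simp

lemma card_mod_7_eq_0: "card {k \<in> {1..m}. k mod 7 = 0} = m div 7"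
proof (induction m)
  case (Suc m)
  have "m div 7 + (if Suc m mod 7 = 0 then 1 else 0) = Suc m div 7"
    by presburger
  then show ?case
    unfolding card_filter_Suc Suc.IH .
qed simp

text \<open>Adding 6 moves residue 1 to residue 0, which leaves the multiples of 7 up to
  \<open>m + 6\<close> to be counted.\<close>

lemma card_mod_7_eq_1: "card {k \<in> {1..m}. k mod 7 = 1} = (m + 6) div 7"
proof (induction m)
  case (Suc m)
  have "(m + 6) div 7 + (if Suc m mod 7 = 1 then 1 else 0) = (Suc m + 6) div 7"
    by presburger
  then show ?case
    unfolding card_filter_Suc Suc.IH .
qed simp

text \<open>A bounded discrepancy disappears after division by \<open>n\<close>.\<close>

lemma tendsto_frequency_seventh:
  fixes c K :: "nat \<Rightarrow> nat"
  assumes "(\<lambda>n. real (K n) / real n) \<longlonglongrightarrow> l"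
    and "\<And>n. \<bar>real (c n) - real (K n) / 7\<bar> \<le> 1"
  shows "(\<lambda>n. real (c n) / real n) \<longlonglongrightarrow> l / 7"
proof -
  have "(\<lambda>n. (real (c n) - real (K n) / 7) / real n) \<longlonglongrightarrow> 0"
  proof (rule tendsto_0_le[OF lim_const_over_n[of 1]])
    show "\<forall>\<^sub>F n in sequentially.
        norm ((real (c n) - real (K n) / 7) / real n) \<le> norm (1 / real n) * 1"
      \<comment> \<open>The bound holds even at \<open>n = 0\<close>, where both quotients are
        0.\<close>
      using assms(2) by (intro always_eventually allI) (simp add: divide_right_mono)
  qed
  from tendsto_add[OF this tendsto_divide[OF assms(1) tendsto_const, of 7]]
  show ?thesis
    by (simp add: diff_divide_distrib)
qed

theorem theorem3:
  fixes x :: real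
  assumes "x \<in> H_set"
  shows "has_digit_freq 0 (f_map x) (8/21) \<and>
         has_digit_freq 1 (f_map x) (5/21) \<and>
         has_digit_freq 2 (f_map x) (8/21)"
proof -
  note rep = ternary_rep_f_map[OF assms]
  define A where "A i n = {j \<in> {1..n}. ternary_digit x j = i}" for i n
  \<comment> \<open>\<open>C 0 n\<close> and \<open>C 1 n\<close> hold the ones of \<open>x\<close>
    that become 0 and 2.\<close>
  define C where "C r n = {j \<in> {1..n}. ternary_digit x j = 1 \<and> ones_upto x j mod 7 = r}" for r n
  define B where "B i n = {j \<in> {1..n}. beta x j = i}" for i n
  have fin: "finite (A i n)" "finite (B i n)" "finite (C i n)" for i n
    by (simp_all add: A_def B_def C_def)
  have freqA: "(\<lambda>n. real (card (A i n)) / real n) \<longlonglongrightarrow> 1/3" if "i \<in> {0, 1, 2}" for i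
    using assms that unfolding H_set_def has_digit_freq_def A_def by blast
  have cardC: "card (C r n) = card {k \<in> {1..card (A 1 n)}. k mod 7 = r}" for r n
    unfolding C_def A_def ones_upto_def by (rule card_filter_rank)
  have C0: "card (C 0 n) = card (A 1 n) div 7" and C1: "card (C 1 n) = (card (A 1 n) + 6) div 7"
    for n unfolding cardC by (rule card_mod_7_eq_0, rule card_mod_7_eq_1)
  have freqC: "(\<lambda>n. real (card (C r n)) / real n) \<longlonglongrightarrow> (1/3) / 7" if "r \<in> {0, 1}" for r
  proof (rule tendsto_frequency_seventh)
    show "(\<lambda>n. real (card (A 1 n)) / real n) \<longlonglongrightarrow> 1/3"
      by (rule freqA) simp
    show "\<bar>real (card (C r n)) - real (card (A 1 n)) / 7\<bar> \<le> 1" for n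
    proof -
      \<comment> \<open>Rounding \<open>m / 7\<close> down or up to an integer changes it by less
        than 1.\<close>
      have "7 * card (C r n) \<le> card (A 1 n) + 7" "card (A 1 n) \<le> 7 * card (C r n) + 7"
        using that C0[of n] C1[of n] by auto
      then show ?thesis by linarith
    qed
  qed
  \<comment> \<open>Since \<open>beta\<close> creates no new 1, the ones of \<open>x\<close> split
    into kept and changed ones, and the kept ones are counted by subtraction.\<close>
  have "B 0 n = A 0 n \<union> C 0 n" "B 2 n = A 2 n \<union> C 1 n" "A 1 n = B 1 n \<union> (C 0 n \<union> C 1 n)" for n
    by (auto simp: A_def B_def C_def beta_def split: if_splits)
  moreover have "A 0 n \<inter> C 0 n = {}" "A 2 n \<inter> C 1 n = {}" "C 0 n \<inter> C 1 n = {}"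
    "B 1 n \<inter> (C 0 n \<union> C 1 n) = {}" for n
    by (auto simp: A_def B_def C_def beta_def)
  ultimately have B0: "card (B 0 n) = card (A 0 n) + card (C 0 n)"
    and B2: "card (B 2 n) = card (A 2 n) + card (C 1 n)"
    and A1: "card (A 1 n) = card (B 1 n) + (card (C 0 n) + card (C 1 n))" for n
    by (simp_all add: card_Un_disjoint fin del: One_nat_def)
  have B1: "real (card (B 1 n)) = real (card (A 1 n)) - (real (card (C 0 n)) + real (card (C 1 n)))"
    for n using A1[of n] by simp
  have "(\<lambda>n. real (card (B 0 n)) / real n) \<longlonglongrightarrow> 1/3 + (1/3)/7"
    "(\<lambda>n. real (card (B 2 n)) / real n) \<longlonglongrightarrow> 1/3 + (1/3)/7"
    "(\<lambda>n. real (card (B 1 n)) / real n) \<longlonglongrightarrow> 1/3 - ((1/3)/7 + (1/3)/7)"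
    unfolding B0 B1 B2 of_nat_add add_divide_distrib diff_divide_distrib
    by (intro tendsto_intros freqA freqC; simp)+
  then show ?thesis
    using ternary_rep_unit_interval[OF rep]
    unfolding has_digit_freq_def ternary_rep_imp_ternary_digit[OF rep] B_def by simp
qed

end
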